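(* Let $T$ be a combinatorial triangulation of a quadrilateral $\mathbf{p}\mathbf{q}\mathbf{r}\mathbf{s}$ into $n$ triangles. Let $W_1,\dots,W_n\in\mathcal{R}$ denote the polynomials expressing (twice) the areas of the triangles of $T$, and let $W_U\in\mathcal{R}$ denote the polynomial expressing (twice) the area of the triangle $\mathbf{p}\mathbf{s}\mathbf{q}$, where $$\mathcal{R}=\mathbb{C}\big[\{x_v,y_v : v\in \mathrm{Vertices}(T)\setminus\{\mathbf{r}\}\},\,t\big].$$ Then $W_U$ is integral over $\mathbb{Z}[W_1,\dots,W_n]$, the subring of $\mathcal{R}$ generated by $W_1,\dots,W_n$.
   Context: A combinatorial triangulation of a quadrilateral $\mathbf{p}\mathbf{q}\mathbf{r}\mathbf{s}$ is a (finite) simplicial complex $T$ homeomorphic to a closed disk, with exactly four vertices $\mathbf{p},\mathbf{q},\mathbf{r},\mathbf{s}$ on the boundary, in this cyclic order. $\mathcal{R}$ is the polynomial ring over $\mathbb{C}$ in independent variables $x_v,y_v$ for each vertex $v\neq\mathbf{r}$ of $T$ and one more variable $t$. For the vertex $\mathbf{r}$ one sets, as elements of $\mathcal{R}$, $x_{\mathbf{r}}=x_{\mathbf{s}}+t(x_{\mathbf{q}}-x_{\mathbf{p}})$ and $y_{\mathbf{r}}=y_{\mathbf{s}}+t(y_{\mathbf{q}}-y_{\mathbf{p}})$ (so that $\mathbf{p}\mathbf{q}\mathbf{r}\mathbf{s}$ is generically a trapezoid, $t$ being the ratio of side $\mathbf{s}\mathbf{r}$ to side $\mathbf{p}\mathbf{q}$).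 For an ordered triple of vertices $(v_1,v_2,v_3)$, twice its oriented area is the element $(x_{v_2}-x_{v_1})(y_{v_3}-y_{v_1})-(x_{v_3}-x_{v_1})(y_{v_2}-y_{v_1})\in\mathcal{R}$. Orienting the boundary of $T$ in the direction $\mathbf{p}\mathbf{q}\mathbf{r}\mathbf{s}$ orients each triangle $\Delta_i$ of $T$ ($1\le i\le n$), and $W_i\in\mathcal{R}$ is twice the oriented area of $\Delta_i$. $W_U\in\mathcal{R}$ is twice the oriented area of the triple $(\mathbf{p},\mathbf{s},\mathbf{q})$ (which need not be a triangle of $T$). *)

theory Defs
  imports
    "HOL-Analysis.Analysis"
    "HOL-Computational_Algebra.Polynomial"
    "HOL-Library.Poly_Mapping"
begin

section \<open>Triangulated quadrilaterals\<close>

text \<open>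
  The complex is a geometric one, in a Euclidean space of arbitrary dimension; every finite
  abstract simplicial complex has such a realization. The positions of the vertices
  only serve to describe the combinatorics and the topology of the complex: the area polynomials
  below use independent indeterminates as coordinates. A vertex of \<open>T\<close> is a point \<open>v\<close> with
  \<open>{v} \<in> T\<close>.
\<close>

definition quad_path :: "'a::euclidean_space \<Rightarrow> 'a \<Rightarrow> 'a \<Rightarrow> 'a \<Rightarrow> 'a set" where
  "quad_path p q r s =
     closed_segment p q \<union> closed_segment q r \<union> closed_segment r s \<union> closed_segment s p"

text \<open>
  The boundary of the disk is the closed path of the four edges \<open>pq\<close>, \<open>qr\<close>, \<open>rs\<close>, \<open>sp\<close> of \<open>T\<close>.
  By invariance of domain this does not depend on the choice of the homeomorphism \<open>h\<close>.
  That the boundary contains no other vertices of \<open>T\<close> is the lemma \<open>boundary_vertices\<close> below.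
\<close>

definition quad_triangulation ::
    "'a::euclidean_space set set \<Rightarrow> 'a \<Rightarrow> 'a \<Rightarrow> 'a \<Rightarrow> 'a \<Rightarrow> bool" where
  "quad_triangulation T p q r s \<longleftrightarrow>
     simplicial_complex T \<and>
     distinct [p, q, r, s] \<and>
     {closed_segment p q, closed_segment q r, closed_segment r s, closed_segment s p} \<subseteq> T \<and>
     (\<exists>h k. homeomorphism (\<Union>T) (cball (0::complex) 1) h k \<and>
            h ` quad_path p q r s = sphere 0 1)"

lemma boundary_vertices:
  assumes "quad_triangulation T p q r s"
  shows "{v. {v} \<in> T \<and> v \<in> quad_path p q r s} = {p, q, r, s}"
proof -
  have T: "simplicial_complex T"
    and E: "closed_segment p q \<in> T" "closed_segment q r \<in> T"
           "closed_segment r s \<in> T" "closed_segment s p \<in> T"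
    using assms by (auto simp: quad_triangulation_def)
  have ends: "v = a \<or> v = b"
    if "{v} \<in> T" "closed_segment a b \<in> T" "v \<in> closed_segment a b" for v a b
  proof -
    have "(closed_segment a b \<inter> {v}) face_of closed_segment a b"
      using T that unfolding simplicial_complex_def by blast
    then have "{v} face_of closed_segment a b"
      using that(3) by (simp add: Int_absorb1)
    then have "v extreme_point_of (convex hull {a, b})"
      by (simp add: face_of_singleton segment_convex_hull)
    then show ?thesis
      using extreme_point_of_convex_hull by blast
  qed
  have vert: "{a} \<in> T" if "closed_segment a b \<in> T" for a b
  proof -
    have "{a} face_of closed_segment a b"
      by (simp add: face_of_singleton extreme_point_of_segment)
    then show ?thesis
      using T that unfolding simplicial_complex_def by blast
  qed
  show ?thesis
    using ends E vert[OF E(1)] vert[OF E(2)] vert[OF E(3)] vert[OF E(4)]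
    unfolding quad_path_def by auto
qed

definition triangles :: "'a::euclidean_space set set \<Rightarrow> 'a set set" where
  "triangles T = {K \<in> T. 2 simplex K}"

text \<open>An oriented triangle is given by a triple of its vertices, in cyclic order.\<close>

fun triangle_hull :: "'a::euclidean_space \<times> 'a \<times> 'a \<Rightarrow> 'a set" where
  "triangle_hull (a, b, c) = convex hull {a, b, c}"

fun directed_edges :: "'a \<times> 'a \<times> 'a \<Rightarrow> ('a \<times> 'a) set" where
  "directed_edges (a, b, c) = {(a, b), (b, c), (c, a)}"

text \<open>
  \<open>\<Delta> 1, \<dots>, \<Delta> n\<close> lists all triangles of \<open>T\<close>, without repetition, with the orientations induced by
  the direction \<open>pqrs\<close> of the boundary: two triangles with a common edge induce opposite
  directions on it, and the boundary edges have the directions induced by their triangles.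
\<close>

definition oriented_triangle_list ::
    "'a::euclidean_space set set \<Rightarrow> 'a \<Rightarrow> 'a \<Rightarrow> 'a \<Rightarrow> 'a \<Rightarrow> nat \<Rightarrow> (nat \<Rightarrow> 'a \<times> 'a \<times> 'a) \<Rightarrow> bool"
  where
  "oriented_triangle_list T p q r s n \<Delta> \<longleftrightarrow>
     bij_betw (\<lambda>i. triangle_hull (\<Delta> i)) {1..n} (triangles T) \<and>
     (\<forall>i\<in>{1..n}. \<forall>j\<in>{1..n}. i \<noteq> j \<longrightarrow> directed_edges (\<Delta> i) \<inter> directed_edges (\<Delta> j) = {}) \<and>
     {(p, q), (q, r), (r, s), (s, p)} \<subseteq> (\<Union>i\<in>{1..n}. directed_edges (\<Delta> i))"


section \<open>Area polynomials\<close>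

datatype 'v indet = IX 'v | IY 'v | IT

text \<open>A polynomial maps monomials, which are finitely supported exponent vectors, to coefficients.\<close>

type_synonym 'v cpoly = "('v indet \<Rightarrow>\<^sub>0 nat) \<Rightarrow>\<^sub>0 complex"

definition indet :: "'v indet \<Rightarrow> 'v cpoly" where
  "indet i = Poly_Mapping.single (Poly_Mapping.single i 1) 1"

definition xcoord :: "'v \<Rightarrow> 'v \<Rightarrow> 'v \<Rightarrow> 'v \<Rightarrow> 'v \<Rightarrow> 'v cpoly" where
  "xcoord p q r s v =
     (if v = r then indet (IX s) + indet IT * (indet (IX q) - indet (IX p)) else indet (IX v))"

definition ycoord :: "'v \<Rightarrow> 'v \<Rightarrow> 'v \<Rightarrow> 'v \<Rightarrow> 'v \<Rightarrow> 'v cpoly" where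
  "ycoord p q r s v =
     (if v = r then indet (IY s) + indet IT * (indet (IY q) - indet (IY p)) else indet (IY v))"

fun twice_area :: "('v \<Rightarrow> 'b::comm_ring_1) \<Rightarrow> ('v \<Rightarrow> 'b) \<Rightarrow> 'v \<times> 'v \<times> 'v \<Rightarrow> 'b" where
  "twice_area x y (a, b, c) = (x b - x a) * (y c - y a) - (x c - x a) * (y b - y a)"

abbreviation area_poly :: "'v \<Rightarrow> 'v \<Rightarrow> 'v \<Rightarrow> 'v \<Rightarrow> 'v \<times> 'v \<times> 'v \<Rightarrow> 'v cpoly" where
  "area_poly p q r s \<equiv> twice_area (xcoord p q r s) (ycoord p q r s)"


section \<open>Subrings and integral elements\<close>

definition is_subring :: "'b::comm_ring_1 set \<Rightarrow> bool" where
  "is_subring A \<longleftrightarrow> 1 \<in> A \<and> (\<forall>a\<in>A. \<forall>b\<in>A. a - b \<in> A \<and> a * b \<in> A)"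

abbreviation subring_generated :: "'b::comm_ring_1 set \<Rightarrow> 'b set" where
  "subring_generated S \<equiv> is_subring hull S"

definition integral_over :: "'b::comm_ring_1 set \<Rightarrow> 'b \<Rightarrow> bool" where
  "integral_over A w \<longleftrightarrow> (\<exists>f. lead_coeff f = 1 \<and> (\<forall>i. coeff f i \<in> A) \<and> poly f w = 0)"

text \<open>
  The ring \<open>\<R>\<close> of polynomials in \<open>t\<close> and the coordinates of the vertices other than \<open>r\<close> is a
  subring of the type \<open>'v cpoly\<close>, and all polynomials that are considered belong to it.
  Neither the subring generated by a subset of \<open>\<R>\<close> nor integrality over it depends on
  whether \<open>\<R>\<close> or all of \<open>'v cpoly\<close> is taken as the ambient ring.
\<close>

definition trapezoid_ring :: "'v::euclidean_space set set \<Rightarrow> 'v \<Rightarrow> 'v cpoly set" where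
  "trapezoid_ring T r =
     {f. \<forall>m\<in>Poly_Mapping.keys f.
           Poly_Mapping.keys m \<subseteq> insert IT (\<Union>v\<in>{v. {v} \<in> T \<and> v \<noteq> r}. {IX v, IY v})}"

lemma is_subring_trapezoid_ring: "is_subring (trapezoid_ring T r)"
proof -
  let ?I = "insert IT (\<Union>v\<in>{v. {v} \<in> T \<and> v \<noteq> r}. {IX v, IY v})"
  have "a - b \<in> trapezoid_ring T r"
    if "a \<in> trapezoid_ring T r" "b \<in> trapezoid_ring T r" for a b
    using that keys_diff[of a b] unfolding trapezoid_ring_def by blast
  moreover have "a * b \<in> trapezoid_ring T r"
    if ab: "a \<in> trapezoid_ring T r" "b \<in> trapezoid_ring T r" for a b
  proof -
    have "Poly_Mapping.keys m \<subseteq> ?I" if m: "m \<in> Poly_Mapping.keys (a * b)" for m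
    proof -
      obtain k l where "m = k + l" "k \<in> Poly_Mapping.keys a" "l \<in> Poly_Mapping.keys b"
        using m keys_mult[of a b] by blast
      then show ?thesis
        using ab Poly_Mapping.keys_add[of k l] unfolding trapezoid_ring_def by blast
    qed
    then show ?thesis
      unfolding trapezoid_ring_def by blast
  qed
  moreover have "1 \<in> trapezoid_ring T r"
    by (simp add: trapezoid_ring_def)
  ultimately show ?thesis
    by (simp add: is_subring_def)
qed

lemma area_poly_in_trapezoid_ring:
  assumes "quad_triangulation T p q r s" and "{a} \<in> T" "{b} \<in> T" "{c} \<in> T"
  shows "area_poly p q r s (a, b, c) \<in> trapezoid_ring T r"
proof -
  let ?R = "trapezoid_ring T r"
  have V: "{p} \<in> T" "{q} \<in> T" "{s} \<in> T" and ne: "p \<noteq> r" "q \<noteq> r" "s \<noteq> r"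
    using boundary_vertices[OF assms(1)] assms(1) by (auto simp: quad_triangulation_def)
  have diff: "u - v \<in> ?R" and mult: "u * v \<in> ?R" if "u \<in> ?R" "v \<in> ?R" for u v
    using is_subring_trapezoid_ring[of T r] that by (auto simp: is_subring_def)
  have "0 \<in> ?R"
    by (simp add: trapezoid_ring_def)
  then have add: "u + v \<in> ?R" if "u \<in> ?R" "v \<in> ?R" for u v
    using diff[of u "0 - v"] diff[of 0 v] that by simp
  have ind: "indet IT \<in> ?R"
    "\<And>v. {v} \<in> T \<Longrightarrow> v \<noteq> r \<Longrightarrow> indet (IX v) \<in> ?R"
    "\<And>v. {v} \<in> T \<Longrightarrow> v \<noteq> r \<Longrightarrow> indet (IY v) \<in> ?R"
    by (auto simp: trapezoid_ring_def indet_def)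
  have "xcoord p q r s v \<in> ?R" "ycoord p q r s v \<in> ?R" if "{v} \<in> T" for v
    using that V ne unfolding xcoord_def ycoord_def by (auto intro!: add diff mult ind)
  then show ?thesis
    using assms(2-4) by (auto intro!: diff mult)
qed

end

theory Submission
  imports Defs "HOL-Complex_Analysis.Winding_Numbers" "HOL-Computational_Algebra.Fraction_Field"
begin

text \<open>
  Over a field, an element that is not integral over a subring \<open>A\<close> lies outside some valuation
  ring \<open>V \<supseteq> A\<close>. Suppose \<open>W\<^sub>U \<notin> V\<close> and use affine coordinates in which \<open>p\<close>, \<open>q\<close>, \<open>s\<close> are \<open>(0, 0)\<close>,
  \<open>(1, 0)\<close>, \<open>(0, 1)\<close>, so that \<open>r\<close> is \<open>(t, 1)\<close>. Monsky's colouring with respect to \<open>V\<close> gives \<open>p\<close>, \<open>q\<close>,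
  \<open>s\<close> three different colours and gives \<open>r\<close> the colour of \<open>q\<close> or of \<open>s\<close>. By Sperner's lemma
  some triangle of \<open>T\<close> has vertices of all three colours. Its area in these coordinates is
  \<open>W\<^sub>i / W\<^sub>U\<close> up to sign and has an inverse in \<open>V\<close>, so \<open>W\<^sub>U \<in> V\<close>, a contradiction.
\<close>

section \<open>Subrings and integrality\<close>

lemma subring_generated_subring: "is_subring (subring_generated S)"
  by (rule hull_in) (auto simp: is_subring_def)

lemma
  assumes "is_subring A"
  shows subring_0: "0 \<in> A"
    and subring_1: "1 \<in> A"
    and subring_diff: "a \<in> A \<Longrightarrow> b \<in> A \<Longrightarrow> a - b \<in> A"
    and subring_mult: "a \<in> A \<Longrightarrow> b \<in> A \<Longrightarrow> a * b \<in> A"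
    and subring_uminus: "a \<in> A \<Longrightarrow> - a \<in> A"
    and subring_add: "a \<in> A \<Longrightarrow> b \<in> A \<Longrightarrow> a + b \<in> A"
proof -
  have diff: "a - b \<in> A" if "a \<in> A" "b \<in> A" for a b
    using assms that by (auto simp: is_subring_def)
  then show "a \<in> A \<Longrightarrow> b \<in> A \<Longrightarrow> a - b \<in> A" .
  show "a \<in> A \<Longrightarrow> b \<in> A \<Longrightarrow> a * b \<in> A"
    using assms by (auto simp: is_subring_def)
  show one: "1 \<in> A"
    using assms by (auto simp: is_subring_def)
  show zero: "0 \<in> A"
    using diff[OF one one] by simp
  show minus: "- a \<in> A" if "a \<in> A" for a
    using diff[OF zero that] by simp
  show "a + b \<in> A" if "a \<in> A" "b \<in> A"
    using diff[OF that(1) minus[OF that(2)]] by simp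
qed

lemma subring_power: "is_subring A \<Longrightarrow> a \<in> A \<Longrightarrow> a ^ n \<in> A"
  by (induction n) (auto intro: subring_1 subring_mult)

lemma subring_sum: "is_subring A \<Longrightarrow> (\<And>i. i \<in> I \<Longrightarrow> f i \<in> A) \<Longrightarrow> sum f I \<in> A"
  by (induction I rule: infinite_finite_induct) (auto intro: subring_0 subring_add)

text \<open>For a subring \<open>A\<close> this is the ring \<open>A[z]\<close>.\<close>

definition adjoin :: "'b::comm_ring_1 set \<Rightarrow> 'b \<Rightarrow> 'b set" where
  "adjoin A z = {poly f z |f. \<forall>i. coeff f i \<in> A}"

lemma adjoin_subring:
  assumes A: "is_subring A"
  shows "is_subring (adjoin A z)"
  unfolding is_subring_def
proof (intro conjI ballI)
  have "\<forall>i. coeff 1 i \<in> A"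
    using subring_0[OF A] subring_1[OF A] by (simp add: coeff_pCons split: nat.split flip: one_pCons)
  then show "1 \<in> adjoin A z"
    unfolding adjoin_def by (intro CollectI exI[of _ 1]) simp
next
  fix a b
  assume "a \<in> adjoin A z" "b \<in> adjoin A z"
  then obtain f g where fg: "\<forall>i. coeff f i \<in> A" "a = poly f z" "\<forall>i. coeff g i \<in> A" "b = poly g z"
    unfolding adjoin_def by auto
  then have "\<forall>i. coeff (f - g) i \<in> A" "\<forall>i. coeff (f * g) i \<in> A"
    by (auto simp: coeff_mult intro!: subring_sum subring_diff subring_mult A)
  moreover have "a - b = poly (f - g) z" "a * b = poly (f * g) z"
    using fg by simp_all
  ultimately show "a - b \<in> adjoin A z" "a * b \<in> adjoin A z"
    unfolding adjoin_def by blast+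
qed

lemma adjoin_superset:
  assumes "is_subring A"
  shows "A \<subseteq> adjoin A z" "z \<in> adjoin A z"
proof -
  show "A \<subseteq> adjoin A z"
  proof
    fix a assume "a \<in> A"
    then have "\<forall>i. coeff [:a:] i \<in> A"
      using subring_0[OF assms] by (simp add: coeff_pCons split: nat.split)
    then show "a \<in> adjoin A z"
      unfolding adjoin_def by (intro CollectI exI[of _ "[:a:]"]) simp
  qed
  have "\<forall>i. coeff [:0, 1:] i \<in> A"
    using subring_0[OF assms] subring_1[OF assms] by (simp add: coeff_pCons split: nat.split)
  then show "z \<in> adjoin A z"
    unfolding adjoin_def by (intro CollectI exI[of _ "[:0, 1:]"]) simp
qed

section \<open>Valuation rings\<close>

text \<open>The span over \<open>A\<close> of the powers of \<open>x\<close> below the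
  \<open>n\<close>-th. For a subring \<open>A\<close>, \<open>adjoin A x\<close> is the union of
  these spans; the explicit bound \<open>n\<close> is what the descent below decreases.\<close>

definition power_span :: "'b::comm_ring_1 set \<Rightarrow> 'b \<Rightarrow> nat \<Rightarrow> 'b set" where
  "power_span A x n = {\<Sum>i<n. c i * x ^ i |c. \<forall>i. c i \<in> A}"

lemma adjoin_imp_power_span:
  assumes "w \<in> adjoin A x"
  obtains n where "w \<in> power_span A x (Suc n)"
proof -
  obtain f where "\<forall>i. coeff f i \<in> A" "w = poly f x"
    using assms unfolding adjoin_def by auto
  then have "w \<in> power_span A x (Suc (degree f))"
    unfolding power_span_def
    by (intro CollectI exI[of _ "coeff f"]) (simp add: poly_altdef lessThan_Suc_atMost)
  then show ?thesis
    using that by blast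
qed

lemma power_span_add:
  assumes "is_subring A" "u \<in> power_span A x n" "v \<in> power_span A x n"
  shows "u + v \<in> power_span A x n"
proof -
  obtain c d where "\<forall>i. c i \<in> A" "u = (\<Sum>i<n. c i * x ^ i)" "\<forall>i. d i \<in> A" "v = (\<Sum>i<n. d i * x ^ i)"
    using assms(2,3) unfolding power_span_def by auto
  then show ?thesis
    unfolding power_span_def
    by (intro CollectI exI[of _ "\<lambda>i. c i + d i"])
       (auto simp: sum.distrib distrib_right intro: subring_add[OF assms(1)])
qed

lemma power_span_scale:
  assumes "is_subring A" "u \<in> power_span A x n" "a \<in> A"
  shows "a * u \<in> power_span A x n"
proof -
  obtain c where "\<forall>i. c i \<in> A" "u = (\<Sum>i<n. c i * x ^ i)"
    using assms(2) unfolding power_span_def by auto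
  then show ?thesis
    unfolding power_span_def
    by (intro CollectI exI[of _ "\<lambda>i. a * c i"])
       (auto simp: sum_distrib_left mult.assoc intro: subring_mult[OF assms(1,3)])
qed

lemma power_span_shift:
  assumes "is_subring A" "u \<in> power_span A x n"
  shows "x ^ k * u \<in> power_span A x (k + n)"
proof -
  obtain c where c: "\<forall>i. c i \<in> A" "u = (\<Sum>i<n. c i * x ^ i)"
    using assms(2) unfolding power_span_def by auto
  have "(\<Sum>i<k + n. (if i < k then 0 else c (i - k)) * x ^ i) = (\<Sum>i<n. c i * x ^ (k + i))"
  proof -
    have "(\<Sum>i<k + n. (if i < k then 0 else c (i - k)) * x ^ i) =
          (\<Sum>i\<in>{k..<k + n}. c (i - k) * x ^ i)"
      by (rule sum.mono_neutral_cong_right) auto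
    also have "\<dots> = (\<Sum>i<n. c i * x ^ (k + i))"
      by (rule sum.reindex_bij_witness[of _ "\<lambda>i. k + i" "\<lambda>i. i - k"]) auto
    finally show ?thesis .
  qed
  also have "\<dots> = x ^ k * u"
    by (simp add: c(2) sum_distrib_left power_add ac_simps)
  finally show ?thesis
    unfolding power_span_def using c(1) subring_0[OF assms(1)]
    by (intro CollectI exI[of _ "\<lambda>i. if i < k then 0 else c (i - k)"]) auto
qed

text \<open>
  If \<open>w \<notin> B\<close> but \<open>inverse w \<in> B\<close> and \<open>B\<close> is maximal with this property, then \<open>1 - c / w\<close> is a
  unit of \<open>B\<close> for \<open>c \<in> B\<close>, and a relation for \<open>w\<close> in powers of \<open>1 / x\<close> lowers the degree
  of one in powers of \<open>x\<close>.
\<close>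

lemma power_span_lower_degree:
  fixes w x :: "'k::field"
  assumes B: "is_subring B" and w: "inverse w \<in> B" "w \<noteq> 0"
    and unit: "\<And>c. c \<in> B \<Longrightarrow> inverse (1 - inverse w * c) \<in> B"
    and wB: "w \<notin> B"
    and x: "x \<noteq> 0" "w \<in> power_span B (inverse x) (Suc n)" "w \<in> power_span B x (Suc m)"
    and nm: "n \<le> m"
  shows "w \<in> power_span B x m"
proof -
  obtain c where c: "\<And>i. c i \<in> B" "w = (\<Sum>i<Suc n. c i * inverse x ^ i)"
    using x(2) unfolding power_span_def by auto
  obtain b where b: "\<And>i. b i \<in> B" "w = (\<Sum>i<Suc m. b i * x ^ i)"
    using x(3) unfolding power_span_def by auto
  \<comment> \<open>Moving the constant term \<open>c 0\<close> to the left side leaves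
    \<open>w * u\<close>. Multiplying by \<open>x ^ n\<close> and dividing by \<open>w * u\<close>
    then expresses \<open>x ^ n\<close> through lower powers of \<open>x\<close>, with the
    coefficients \<open>d i\<close>.\<close>
  define u where "u = 1 - inverse w * c 0"
  have wu: "w * u = w - c 0"
    using w(2) by (simp add: u_def right_diff_distrib flip: mult.assoc)
  have u0: "u \<noteq> 0"
    using wu c(1)[of 0] wB by auto
  define d where "d i = inverse w * (inverse u * c (n - i))" for i
  have d: "d i \<in> B" for i
    unfolding d_def u_def by (intro subring_mult[OF B] w unit c)
  have "w * u = (\<Sum>i<n. c (Suc i) * inverse x ^ Suc i)"
    unfolding wu using c(2) by (simp only: sum.lessThan_Suc_shift) simp
  also have "\<dots> = (\<Sum>i<n. c (n - i) * inverse x ^ (n - i))"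
    by (rule sum.reindex_bij_witness[of _ "\<lambda>i. n - Suc i" "\<lambda>i. n - Suc i"]) auto
  finally have "w * u * x ^ n = (\<Sum>i<n. c (n - i) * (inverse x ^ (n - i) * x ^ n))"
    by (simp add: sum_distrib_right mult.assoc)
  also have "\<dots> = (\<Sum>i<n. c (n - i) * x ^ i)"
  proof (rule sum.cong[OF refl])
    fix i assume "i \<in> {..<n}"
    then have "x ^ n = x ^ (n - i) * x ^ i"
      by (simp flip: power_add)
    then show "c (n - i) * (inverse x ^ (n - i) * x ^ n) = c (n - i) * x ^ i"
      using x(1) by (simp add: power_inverse flip: mult.assoc)
  qed
  finally have e: "w * u * x ^ n = (\<Sum>i<n. c (n - i) * x ^ i)" .
  have "x ^ n = inverse w * inverse u * (w * u * x ^ n)"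
    using w(2) u0 by (simp add: field_simps)
  also have "\<dots> = (\<Sum>i<n. d i * x ^ i)"
    unfolding e d_def by (simp add: sum_distrib_left mult.assoc)
  finally have xn: "x ^ n \<in> power_span B x n"
    unfolding power_span_def using d by blast
  \<comment> \<open>Shifting the expression for \<open>x ^ n\<close> turns the top power
    \<open>x ^ m\<close> of the other relation into a combination of lower powers.\<close>
  have "x ^ m = x ^ (m - n) * x ^ n"
    using nm by (simp flip: power_add)
  with power_span_shift[OF B xn, of "m - n"] nm have "x ^ m \<in> power_span B x m"
    by simp
  moreover have "(\<Sum>i<m. b i * x ^ i) \<in> power_span B x m"
    unfolding power_span_def using b(1) by blast
  ultimately show ?thesis
    using b(2) power_span_add[OF B] power_span_scale[OF B _ b(1)] by simp
qed

lemma power_span_1: "power_span A x (Suc 0) = A"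
  unfolding power_span_def by (auto intro: exI[of _ "\<lambda>_. a" for a])

text \<open>Descent on \<open>m + n\<close>: the relation of larger degree can be lowered, with
  \<open>x\<close> and \<open>inverse x\<close> exchanging roles if \<open>m < n\<close>. A relation
  of degree 0 would put \<open>w\<close> into \<open>B\<close>.\<close>

lemma not_in_both_power_spans:
  fixes w x :: "'k::field"
  assumes B: "is_subring B" and w: "inverse w \<in> B" "w \<noteq> 0"
    and unit: "\<And>c. c \<in> B \<Longrightarrow> inverse (1 - inverse w * c) \<in> B"
    and wB: "w \<notin> B" and x: "x \<noteq> 0"
  shows "\<not> (w \<in> power_span B x (Suc m) \<and> w \<in> power_span B (inverse x) (Suc n))"
proof (induction "m + n" arbitrary: m n rule: less_induct)
  case less
  show ?case
  proof
    assume *: "w \<in> power_span B x (Suc m) \<and> w \<in> power_span B (inverse x) (Suc n)"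
    then have "m \<noteq> 0" "n \<noteq> 0"
      using wB by (metis power_span_1)+
    then obtain m' n' where mn: "m = Suc m'" "n = Suc n'"
      by (meson not0_implies_Suc)
    show False
    proof (cases "n \<le> m")
      case True
      then have "w \<in> power_span B x m"
        using power_span_lower_degree[OF B w unit wB x] * by blast
      then show False
        using less[of m' n] * mn by simp
    next
      case False
      then have "w \<in> power_span B (inverse x) n"
        using power_span_lower_degree[OF B w unit wB, of "inverse x" m n] * x by simp
      then show False
        using less[of m n'] * mn by simp
    qed
  qed
qed

definition valuation_subring :: "'k::field set \<Rightarrow> bool" where
  "valuation_subring V \<longleftrightarrow> is_subring V \<and> (\<forall>x. x \<in> V \<or> inverse x \<in> V)"

text \<open>Multiplying a relation \<open>w = c 0 + c 1 / w + ... + c n / w ^ n\<close> by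
  \<open>w ^ n\<close> gives a monic equation of degree \<open>n + 1\<close> for
  \<open>w\<close>.\<close>

lemma integral_if_in_adjoin_inverse:
  fixes w :: "'k::field"
  assumes A: "is_subring A" and w: "w \<in> adjoin A (inverse w)" and w0: "w \<noteq> 0"
  shows "integral_over A w"
proof -
  obtain n where "w \<in> power_span A (inverse w) (Suc n)"
    using adjoin_imp_power_span[OF w] .
  then obtain c where c: "\<And>i. c i \<in> A" "w = (\<Sum>i<Suc n. c i * inverse w ^ i)"
    unfolding power_span_def by auto
  define g where "g = (\<Sum>i<Suc n. monom (c i) (n - i))"
  define f where "f = monom 1 (Suc n) - g"
  have g: "coeff g j \<in> A" for j
    unfolding g_def coeff_sum by (auto intro!: subring_sum[OF A] simp: c subring_0[OF A])
  have "degree g \<le> n"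
    unfolding g_def by (rule degree_sum_le) (auto intro: order.trans[OF degree_monom_le])
  then have g0: "coeff g j = 0" if "j > n" for j
    using that by (intro coeff_eq_0) simp
  have f: "coeff f (Suc n) = 1"
    by (simp add: f_def g0)
  moreover have "degree f \<le> Suc n"
    by (rule degree_le) (auto simp: f_def g0)
  ultimately have "degree f = Suc n"
    by (simp add: le_degree order_antisym)
  then have "lead_coeff f = 1"
    using f by simp
  moreover have "coeff f i \<in> A" for i
    unfolding f_def coeff_diff coeff_monom
    by (intro subring_diff[OF A] g) (simp add: subring_0[OF A] subring_1[OF A])
  moreover have "poly f w = 0"
  proof -
    have "poly g w = (\<Sum>i<Suc n. c i * w ^ (n - i))"
      by (simp add: g_def poly_sum poly_monom del: sum.lessThan_Suc)
    also have "\<dots> = (\<Sum>i<Suc n. c i * inverse w ^ i) * w ^ n"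
      unfolding sum_distrib_right
    proof (rule sum.cong[OF refl])
      fix i assume "i \<in> {..<Suc n}"
      then have "w ^ n = w ^ i * w ^ (n - i)"
        by (simp flip: power_add)
      then show "c i * w ^ (n - i) = c i * inverse w ^ i * w ^ n"
        using w0 by (simp add: power_inverse field_simps)
    qed
    also have "\<dots> = w ^ Suc n"
      by (simp only: c(2)[symmetric] power_Suc)
    finally show ?thesis
      by (simp add: f_def poly_monom)
  qed
  ultimately show ?thesis
    unfolding integral_over_def by blast
qed


text \<open>Non-integrality keeps \<open>w\<close> out of \<open>A[1/w]\<close>, so Zorn's lemma
  yields a subring \<open>B\<close> that is maximal among those containing \<open>A\<close> and
  \<open>1/w\<close> but not \<open>w\<close>. If neither \<open>x\<close> nor \<open>1/x\<close>
  were in \<open>B\<close>, both \<open>B[x]\<close> and \<open>B[1/x]\<close> would contain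
  \<open>w\<close>, against \<open>not_in_both_power_spans\<close>.\<close>

theorem ex_valuation_subring_not_integral:
  fixes w :: "'k::field"
  assumes A: "is_subring A" and w: "\<not> integral_over A w"
  obtains V where "valuation_subring V" "A \<subseteq> V" "w \<notin> V"
proof -
  have w0: "w \<noteq> 0"
  proof
    assume "w = 0"
    then have "integral_over A w"
      unfolding integral_over_def using subring_0[OF A] subring_1[OF A]
      by (intro exI[of _ "monom 1 1"]) (simp add: degree_monom_eq poly_monom)
    with w show False ..
  qed
  define F where "F = {B. is_subring B \<and> A \<subseteq> B \<and> inverse w \<in> B \<and> w \<notin> B}"
  have "adjoin A (inverse w) \<in> F"
    using adjoin_subring[OF A] adjoin_superset[OF A] integral_if_in_adjoin_inverse[OF A _ w0] w
    unfolding F_def by blast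
  moreover have "\<Union>C \<in> F" if C: "C \<noteq> {}" "subset.chain F C" for C
  proof -
    have CF: "C \<subseteq> F" and chain: "\<And>X Y. X \<in> C \<Longrightarrow> Y \<in> C \<Longrightarrow> X \<subseteq> Y \<or> Y \<subseteq> X"
      using C(2) unfolding subset.chain_def by blast+
    have "a - b \<in> \<Union>C \<and> a * b \<in> \<Union>C" if ab: "a \<in> \<Union>C" "b \<in> \<Union>C" for a b
    proof -
      obtain X Y where "X \<in> C" "a \<in> X" "Y \<in> C" "b \<in> Y"
        using ab by blast
      then obtain Z where "Z \<in> C" "a \<in> Z" "b \<in> Z"
        using chain[of X Y] by blast
      moreover from this have "is_subring Z"
        using CF by (auto simp: F_def)
      ultimately show ?thesis
        using subring_diff subring_mult by blast
    qed
    moreover have "1 \<in> \<Union>C"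
      using C(1) CF by (auto simp: F_def is_subring_def)
    ultimately have "is_subring (\<Union>C)"
      by (auto simp: is_subring_def)
    moreover obtain X where "X \<in> C" "X \<in> F"
      using C(1) CF by blast
    ultimately show ?thesis
      using CF unfolding F_def by blast
  qed
  ultimately obtain B where BF: "B \<in> F" and max: "\<And>X. X \<in> F \<Longrightarrow> B \<subseteq> X \<Longrightarrow> X = B"
    using subset_Zorn_nonempty[of F] by blast
  have B: "is_subring B" "A \<subseteq> B" "inverse w \<in> B" "w \<notin> B"
    using BF by (auto simp: F_def)
  \<comment> \<open>A proper extension of \<open>B\<close> cannot belong to \<open>F\<close>, and
    the only condition it can violate is the exclusion of \<open>w\<close>.\<close>
  have adj: "w \<in> adjoin B x" if "x \<notin> B" for x
  proof (rule ccontr)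
    assume "w \<notin> adjoin B x"
    then have "adjoin B x \<in> F"
      using adjoin_subring[OF B(1), of x] adjoin_superset[OF B(1), of x] B by (auto simp: F_def)
    then show False
      using max adjoin_superset[OF B(1), of x] that by blast
  qed
  \<comment> \<open>If \<open>1/u\<close> were missing, \<open>w\<close> would be a polynomial in
    \<open>1/u\<close> over \<open>B\<close>, so \<open>w * u ^ n\<close> would lie in
    \<open>B\<close>. As \<open>w * (1 - u) = c\<close>, also \<open>w * (1 - u ^ n)\<close> lies in
    \<open>B\<close>, and the sum of the two is \<open>w\<close>.\<close>
  have unit: "inverse (1 - inverse w * c) \<in> B" if c: "c \<in> B" for c
  proof (rule ccontr)
    define u where "u = 1 - inverse w * c"
    assume "inverse (1 - inverse w * c) \<notin> B"
    then obtain n where "w \<in> power_span B (inverse u) (Suc n)"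
      unfolding u_def using adj adjoin_imp_power_span by metis
    then obtain b where b: "\<And>i. b i \<in> B" "w = (\<Sum>i<Suc n. b i * inverse u ^ i)"
      unfolding power_span_def by auto
    have uB: "u \<in> B"
      unfolding u_def by (intro subring_diff[OF B(1)] subring_1[OF B(1)] subring_mult[OF B(1)] B c)
    have u0: "u \<noteq> 0"
      using c B(4) w0 by (auto simp: u_def field_simps)
    have "w * u ^ n = (\<Sum>i<Suc n. b i * u ^ (n - i))"
    proof -
      have "w * u ^ n = (\<Sum>i<Suc n. b i * inverse u ^ i * u ^ n)"
        by (subst b(2)) (rule sum_distrib_right)
      also have "\<dots> = (\<Sum>i<Suc n. b i * u ^ (n - i))"
      proof (rule sum.cong[OF refl])
        fix i assume "i \<in> {..<Suc n}"
        then have "u ^ n = u ^ i * u ^ (n - i)"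
          by (simp flip: power_add)
        then show "b i * inverse u ^ i * u ^ n = b i * u ^ (n - i)"
          using u0 by (simp add: power_inverse field_simps)
      qed
      finally show ?thesis .
    qed
    then have *: "w * u ^ n \<in> B"
      by (simp only:) (intro subring_sum[OF B(1)] subring_mult[OF B(1)] subring_power[OF B(1)] uB b)
    have "w * (1 - u ^ k) \<in> B" for k
    proof (induction k)
      case 0
      then show ?case
        by (simp add: subring_0[OF B(1)])
    next
      case (Suc k)
      have "w * (1 - u ^ Suc k) = w * (1 - u ^ k) + c * u ^ k"
        using w0 by (simp add: u_def field_simps)
      moreover have "c * u ^ k \<in> B"
        by (intro subring_mult[OF B(1)] subring_power[OF B(1)] uB c)
      ultimately show ?case
        using subring_add[OF B(1) Suc] by simp
    qed
    from subring_add[OF B(1) this[of n] * ] show False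
      using B(4) by (simp add: algebra_simps)
  qed
  have "x \<in> B \<or> inverse x \<in> B" for x
  proof (cases "x = 0")
    case True
    then show ?thesis
      by (simp add: subring_0[OF B(1)])
  next
    case False
    show ?thesis
    proof (rule ccontr)
      assume "\<not> ?thesis"
      then have "w \<in> adjoin B x" "w \<in> adjoin B (inverse x)"
        using adj by blast+
      then obtain m n where "w \<in> power_span B x (Suc m)" "w \<in> power_span B (inverse x) (Suc n)"
        using adjoin_imp_power_span by metis
      then show False
        using not_in_both_power_spans[OF B(1,3) w0 unit B(4) False] by blast
    qed
  qed
  then show ?thesis
    using B that by (auto simp: valuation_subring_def)
qed

section \<open>The order given by a valuation ring, and Monsky's colouring\<close>

locale valuation_ring =
  fixes V :: "'k::field set"
  assumes valuation_subring: "valuation_subring V"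
begin

lemma subring: "is_subring V"
  using valuation_subring by (simp add: valuation_subring_def)

text \<open>This is the comparison of absolute values for the valuation of \<open>V\<close>,
  expressed by divisibility so that no value group has to be constructed.\<close>

definition le :: "'k \<Rightarrow> 'k \<Rightarrow> bool" (infix "\<sqsubseteq>" 50) where
  "x \<sqsubseteq> y \<longleftrightarrow> (\<exists>v\<in>V. x = v * y)"

abbreviation less :: "'k \<Rightarrow> 'k \<Rightarrow> bool" (infix "\<sqsubset>" 50) where
  "x \<sqsubset> y \<equiv> \<not> y \<sqsubseteq> x"

lemma le_refl: "x \<sqsubseteq> x"
  unfolding le_def by (rule bexI[of _ 1]) (simp_all add: subring_1[OF subring])

lemma le_trans: "x \<sqsubseteq> y \<Longrightarrow> y \<sqsubseteq> z \<Longrightarrow> x \<sqsubseteq> z"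
  unfolding le_def using subring_mult[OF subring] by (fastforce simp flip: mult.assoc)

lemma le_total: "x \<sqsubseteq> y \<or> y \<sqsubseteq> x"
proof (cases "x = 0 \<or> y = 0")
  case True
  then show ?thesis
    unfolding le_def using subring_0[OF subring] by force
next
  case False
  then have "x = x / y * y" "y = inverse (x / y) * x"
    by (simp_all add: field_simps)
  then show ?thesis
    unfolding le_def using valuation_subring[unfolded valuation_subring_def] by blast
qed

lemma le_add: "x \<sqsubseteq> z \<Longrightarrow> y \<sqsubseteq> z \<Longrightarrow> x + y \<sqsubseteq> z"
  unfolding le_def using subring_add[OF subring] by (fastforce simp flip: distrib_right)

lemma le_uminus: "x \<sqsubseteq> z \<Longrightarrow> - x \<sqsubseteq> z"
  unfolding le_def using subring_uminus[OF subring] by (metis mult_minus_left)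

lemma less_uminus: "x \<sqsubset> z \<Longrightarrow> - x \<sqsubset> z"
  unfolding le_def using subring_uminus[OF subring] by (metis minus_mult_commute)

lemma le_mult: "x \<sqsubseteq> y \<Longrightarrow> z \<sqsubseteq> u \<Longrightarrow> x * z \<sqsubseteq> y * u"
proof -
  assume "x \<sqsubseteq> y" "z \<sqsubseteq> u"
  then obtain v w where "v \<in> V" "x = v * y" "w \<in> V" "z = w * u"
    unfolding le_def by blast
  then have "v * w \<in> V" "x * z = (v * w) * (y * u)"
    by (simp_all add: subring_mult[OF subring])
  then show ?thesis
    unfolding le_def by blast
qed

lemma less_add: "x \<sqsubset> z \<Longrightarrow> y \<sqsubset> z \<Longrightarrow> x + y \<sqsubset> z"
  using le_total[of x y] le_add[of x y y] le_add[of x x y] le_refl[of x] le_refl[of y]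
    le_trans[of z "x + y" x] le_trans[of z "x + y" y] by blast

text \<open>Otherwise \<open>z\<close> would be the sum of the two strictly smaller elements
  \<open>x\<close> and \<open>z - x\<close>.\<close>

lemma le_diff_of_less: "x \<sqsubset> z \<Longrightarrow> z \<sqsubseteq> z - x"
  using less_add[of z x "z - x"] le_refl[of z] by auto

lemma less_mult: "x \<sqsubset> y \<Longrightarrow> z \<sqsubseteq> u \<Longrightarrow> u \<noteq> 0 \<Longrightarrow> x * z \<sqsubset> y * u"
proof
  assume *: "x \<sqsubset> y" "z \<sqsubseteq> u" "u \<noteq> 0" "y * u \<sqsubseteq> x * z"
  then obtain v v' where v: "v \<in> V" "z = v * u" "v' \<in> V" "y * u = v' * (x * z)"
    unfolding le_def by auto
  then have "y * u = v' * v * x * u"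
    by (simp add: ac_simps)
  then have "y = v' * v * x"
    using *(3) by simp
  then show False
    using * v subring_mult[OF subring] unfolding le_def by blast
qed

text \<open>Monsky's colouring: the colours 0, 1, 2 say that \<open>1\<close>, \<open>x\<close>,
  \<open>y\<close>, respectively, is largest. Ties are broken in favour of \<open>x\<close>, then of
  \<open>y\<close>.\<close>

definition colour :: "'k \<Rightarrow> 'k \<Rightarrow> nat" where
  "colour x y = (if x \<sqsubset> 1 \<and> y \<sqsubset> 1 then 0 else if y \<sqsubseteq> x then 1 else 2)"

lemma colour_eq_0: "colour x y = 0 \<longleftrightarrow> x \<sqsubset> 1 \<and> y \<sqsubset> 1"
  by (simp add: colour_def)

lemma colour_eq_1: "colour x y = 1 \<longleftrightarrow> 1 \<sqsubseteq> x \<and> y \<sqsubseteq> x"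
  using le_trans[of 1 y x] by (auto simp: colour_def)

lemma colour_eq_2: "colour x y = 2 \<longleftrightarrow> 1 \<sqsubseteq> y \<and> x \<sqsubset> y"
  using le_trans[of 1 x y] le_total[of x y] by (auto simp: colour_def)

text \<open>Translating the point of colour 0 to the origin preserves the dominance of
  \<open>xb\<close> and \<open>yc\<close>. Hence the diagonal product of the determinant has size at
  least 1 and strictly exceeds the other product, which cannot cancel it.\<close>

lemma rainbow_det:
  assumes "colour xa ya = 0" "colour xb yb = 1" "colour xc yc = 2"
  shows "1 \<sqsubseteq> (xb - xa) * (yc - ya) - (xc - xa) * (yb - ya)"
proof -
  have a: "xa \<sqsubset> 1" "ya \<sqsubset> 1" and b: "1 \<sqsubseteq> xb" "yb \<sqsubseteq> xb" and c: "1 \<sqsubseteq> yc" "xc \<sqsubset> yc"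
    using assms unfolding colour_eq_0 colour_eq_1 colour_eq_2 by blast+
  have "xa \<sqsubset> xb" "ya \<sqsubset> yc"
    using a b c le_trans[of 1 xb xa] le_trans[of 1 yc ya] by blast+
  then have X: "xb \<sqsubseteq> xb - xa" and Y: "yc \<sqsubseteq> yc - ya"
    by (auto intro: le_diff_of_less)
  have X1: "1 \<sqsubseteq> xb - xa" and Y1: "1 \<sqsubseteq> yc - ya"
    using le_trans[OF b(1) X] le_trans[OF c(1) Y] .
  then have X0: "xb - xa \<noteq> 0"
    unfolding le_def by auto
  have "ya \<sqsubseteq> xb - xa"
    using a(2) X1 le_trans[of ya 1 "xb - xa"] le_total[of ya 1] by blast
  then have "yb - ya \<sqsubseteq> xb - xa"
    using le_add[OF le_trans[OF b(2) X] le_uminus] by simp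
  moreover have "xc - xa \<sqsubset> yc - ya"
  proof -
    have "xc \<sqsubset> yc - ya" "xa \<sqsubset> yc - ya"
      using a(1) c(2) le_trans[OF Y, of xc] le_trans[OF Y1, of xa] by blast+
    then show ?thesis
      using less_add[OF _ less_uminus, of "yc - ya" xc xa] by simp
  qed
  ultimately have "(xc - xa) * (yb - ya) \<sqsubset> (yc - ya) * (xb - xa)"
    using X0 by (intro less_mult)
  then have "(yc - ya) * (xb - xa) \<sqsubseteq> (yc - ya) * (xb - xa) - (xc - xa) * (yb - ya)"
    by (rule le_diff_of_less)
  moreover have "1 \<sqsubseteq> (yc - ya) * (xb - xa)"
    using le_mult[OF Y1 X1] by simp
  ultimately show ?thesis
    using le_trans[of 1 "(yc - ya) * (xb - xa)"] by (simp only: mult.commute)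
qed

end

text \<open>The algebraic half of the proof; \<open>rainbow\<close> is what topology has to supply.
  It is assumed for all colourings because the valuation ring, and with it the colouring, is only
  found inside the proof.\<close>

lemma integral_if_rainbow_area:
  fixes x y :: "'v \<Rightarrow> 'k::field"
  assumes A: "is_subring A"
    and r: "x r = x s + t * (x q - x p)" "y r = y s + t * (y q - y p)"
    and rainbow: "\<And>col :: 'v \<Rightarrow> nat. range col \<subseteq> {0, 1, 2} \<Longrightarrow> col p = 0 \<Longrightarrow> col q = 1 \<Longrightarrow>
      col r \<in> {1, 2} \<Longrightarrow> col s = 2 \<Longrightarrow>
      \<exists>a b c. col a = 0 \<and> col b = 1 \<and> col c = 2 \<and> twice_area x y (a, b, c) \<in> A"
  shows "integral_over A (twice_area x y (p, s, q))"
proof (rule ccontr)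
  assume "\<not> integral_over A (twice_area x y (p, s, q))"
  then obtain V where V: "valuation_subring V" "A \<subseteq> V" "twice_area x y (p, s, q) \<notin> V"
    using ex_valuation_subring_not_integral[OF A] by metis
  interpret valuation_ring V
    using V(1) by unfold_locales
  define D where "D = twice_area x y (p, q, s)"
  have "twice_area x y (p, s, q) = - D"
    by (simp add: D_def)
  then have DV: "D \<notin> V"
    using V(3) subring_uminus[OF subring, of D] by auto
  then have D0: "D \<noteq> 0"
    using subring_0[OF subring] by auto
  \<comment> \<open>Cramer's rule: these area ratios are the affine coordinates that send
    \<open>p\<close>, \<open>q\<close>, \<open>s\<close> to the standard triangle.\<close>
  define \<alpha> \<beta> where "\<alpha> v = twice_area x y (p, v, s) / D" and "\<beta> v = twice_area x y (p, q, v) / D" for v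
  have "twice_area x y (p, r, s) = t * D" "twice_area x y (p, q, r) = D"
    unfolding D_def by (simp_all add: r algebra_simps)
  then have r': "\<alpha> r = t" "\<beta> r = 1"
    using D0 by (simp_all add: \<alpha>_def \<beta>_def)
  have pqs: "\<alpha> p = 0" "\<beta> p = 0" "\<alpha> q = 1" "\<beta> q = 0" "\<alpha> s = 0" "\<beta> s = 1"
    using D0 unfolding \<alpha>_def \<beta>_def D_def[symmetric] by simp_all
  have le01: "le 0 1" "\<not> le 1 0"
    using subring_0[OF subring] by (auto simp: le_def)
  define col where "col v = colour (\<alpha> v) (\<beta> v)" for v
  have "range col \<subseteq> {0, 1, 2}"
    by (auto simp: col_def colour_def)
  \<comment> \<open>The second coordinate of \<open>r\<close> is 1, so \<open>r\<close> never gets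
    colour 0, whatever \<open>t\<close> is.\<close>
  moreover have "col p = 0" "col q = 1" "col r \<in> {1, 2}" "col s = 2"
    using le01 le_refl[of 1] by (auto simp: col_def colour_def pqs r')
  ultimately obtain a b c where abc: "col a = 0" "col b = 1" "col c = 2" "twice_area x y (a, b, c) \<in> A"
    using rainbow by metis
  define d where "d = (\<alpha> b - \<alpha> a) * (\<beta> c - \<beta> a) - (\<alpha> c - \<alpha> a) * (\<beta> b - \<beta> a)"
  have "le 1 d"
    unfolding d_def using abc(1-3) unfolding col_def by (rule rainbow_det)
  then obtain v where v: "v \<in> V" "1 = v * d"
    unfolding le_def by blast
  \<comment> \<open>The matrix with columns \<open>q - p\<close> and \<open>s - p\<close>, whose
    determinant is \<open>D\<close>, relates the affine coordinates to \<open>x\<close> and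
    \<open>y\<close>.\<close>
  define e f g h where "e = x q - x p" and "f = x s - x p" and "g = y q - y p" and "h = y s - y p"
  have Da: "D * \<alpha> u = twice_area x y (p, u, s)" "D * \<beta> u = twice_area x y (p, q, u)" for u
    using D0 by (simp_all add: \<alpha>_def \<beta>_def)
  have \<alpha>: "D * (\<alpha> u - \<alpha> a) = (x u - x a) * h - f * (y u - y a)"
    and \<beta>: "D * (\<beta> u - \<beta> a) = e * (y u - y a) - (x u - x a) * g" for u
    unfolding right_diff_distrib[of D] Da by (simp_all add: e_def f_def g_def h_def algebra_simps)
  have D: "D = e * h - f * g"
    by (simp add: D_def e_def f_def g_def h_def)
  \<comment> \<open>Each affine coordinate has denominator \<open>D\<close>, so the factor
    \<open>D * D\<close> clears those of the determinant \<open>d\<close>; one \<open>D\<close> is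
    cancelled afterwards.\<close>
  have "D * (D * d) = D * (\<alpha> b - \<alpha> a) * (D * (\<beta> c - \<beta> a)) - D * (\<alpha> c - \<alpha> a) * (D * (\<beta> b - \<beta> a))"
    by (simp add: d_def algebra_simps)
  also have "\<dots> = D * twice_area x y (a, b, c)"
    unfolding \<alpha> \<beta> unfolding D by (simp add: algebra_simps)
  finally have "D * d = twice_area x y (a, b, c)"
    using D0 by simp
  moreover have "D = v * (D * d)"
    by (simp only: mult.left_commute[of v D] v(2)[symmetric] mult_1_right)
  ultimately have "D = v * twice_area x y (a, b, c)"
    by (simp only:)
  then show False
    using DV subring_mult[OF subring v(1)] abc(4) V(2) by auto
qed

section \<open>Sperner's lemma for triangulated quadrilaterals\<close>

lemma affine_independent_extend:
  fixes c :: "'a::euclidean_space \<Rightarrow> 'b::real_vector"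
  assumes "\<not> affine_dependent C"
  obtains g d where "linear g" "\<And>x. x \<in> C \<Longrightarrow> g x + d = c x"
proof (cases "C = {}")
  case True
  then show ?thesis
    using that[of "\<lambda>_. 0" 0] by (simp add: linear_0 module_hom_zero)
next
  case False
  then obtain a where a: "a \<in> C"
    by blast
  then have "independent ((\<lambda>x. - a + x) ` (C - {a}))"
    using assms affine_dependent_iff_dependent2 by blast
  then obtain g where g: "linear g" "\<And>x. x \<in> C - {a} \<Longrightarrow> g (- a + x) = c x - c a"
    using linear_independent_extend[of "(\<lambda>x. - a + x) ` (C - {a})" "\<lambda>z. c (a + z) - c a"] by auto
  have "g x + (c a - g a) = c x" if "x \<in> C" for x
    using g(2)[of x] that linear_diff[OF g(1), of x a] by (cases "x = a") (auto simp: algebra_simps)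
  then show ?thesis
    using that g(1) by blast
qed

lemma
  assumes "simplicial_complex T"
  shows simplicial_complex_finite: "finite T"
    and simplicial_complex_simplex: "K \<in> T \<Longrightarrow> \<exists>C. \<not> affine_dependent C \<and> K = convex hull C"
    and simplicial_complex_face: "K \<in> T \<Longrightarrow> F face_of K \<Longrightarrow> F \<in> T"
    and simplicial_complex_Int_face: "K \<in> T \<Longrightarrow> L \<in> T \<Longrightarrow> K \<inter> L face_of K"
  using assms unfolding simplicial_complex_def simplex_def by meson+

lemma simplicial_complex_extreme_points:
  assumes "simplicial_complex T" "K \<in> T"
  shows "\<not> affine_dependent {v. v extreme_point_of K}" "convex hull {v. v extreme_point_of K} = K"
proof -
  obtain C where C: "\<not> affine_dependent C" "K = convex hull C"
    using simplicial_complex_simplex[OF assms] by blast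
  then have "{v. v extreme_point_of K} = C"
    by (auto simp: extreme_point_of_convex_hull_affine_independent)
  with C show "\<not> affine_dependent {v. v extreme_point_of K}" "convex hull {v. v extreme_point_of K} = K"
    by simp_all
qed

text \<open>On each simplex the prescribed vertex values extend affinely. These extensions agree on
  intersections, and gluing over finitely many closed simplices preserves continuity.\<close>

theorem simplicial_map_exists:
  fixes c :: "'a::euclidean_space \<Rightarrow> 'b::euclidean_space"
  assumes T: "simplicial_complex T"
  obtains f where "continuous_on (\<Union>T) f" "\<And>v. {v} \<in> T \<Longrightarrow> f v = c v"
    "\<And>K x y u v. K \<in> T \<Longrightarrow> x \<in> K \<Longrightarrow> y \<in> K \<Longrightarrow> u \<ge> 0 \<Longrightarrow> v \<ge> 0 \<Longrightarrow> u + v = (1::real) \<Longrightarrow>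
      f (u *\<^sub>R x + v *\<^sub>R y) = u *\<^sub>R f x + v *\<^sub>R f y"
proof -
  have "\<exists>g d. linear g \<and> (\<forall>x. x extreme_point_of K \<longrightarrow> g x + d = c x)" if K: "K \<in> T" for K
    by (rule affine_independent_extend[OF simplicial_complex_extreme_points(1)[OF T K], of c]) auto
  then obtain g d where g: "\<And>K. K \<in> T \<Longrightarrow> linear (g K)"
    and gd: "\<And>K x. K \<in> T \<Longrightarrow> x extreme_point_of K \<Longrightarrow> g K x + d K = c x"
    by metis
  define G where "G K x = g K x + d K" for K x
  have G: "G K (u *\<^sub>R x + v *\<^sub>R y) = u *\<^sub>R G K x + v *\<^sub>R G K y"
    if "K \<in> T" "u + v = 1" for K x y u v
  proof -
    have "u *\<^sub>R G K x + v *\<^sub>R G K y = u *\<^sub>R g K x + v *\<^sub>R g K y + (u + v) *\<^sub>R d K"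
      by (simp add: G_def algebra_simps)
    then show ?thesis
      using that by (simp add: G_def linear_add[OF g] linear_scale[OF g])
  qed
  \<comment> \<open>The intersection is a common face, hence the hull of common vertices. Both
    affine maps agree at these, and the set where they agree is convex.\<close>
  have agree: "G K x = G L x" if K: "K \<in> T" "x \<in> K" and L: "L \<in> T" "x \<in> L" for K L x
  proof -
    let ?E = "{v. v extreme_point_of K}"
    have faces: "K \<inter> L face_of K" "K \<inter> L face_of L"
      using simplicial_complex_Int_face[OF T] K(1) L(1) by (metis Int_commute)+
    note indep = simplicial_complex_extreme_points(1)[OF T K(1)]
    have "K \<inter> L face_of convex hull ?E"
      using faces(1) simplicial_complex_extreme_points(2)[OF T K(1)] by simp
    then obtain C where C: "C \<subseteq> ?E" "K \<inter> L = convex hull C"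
      using face_of_convex_hull_affine_independent[OF indep] by blast
    have "v extreme_point_of L" if "v \<in> C" for v
      using that C affine_independent_subset[OF indep C(1)] faces(2)
      by (metis extreme_point_of_convex_hull_affine_independent extreme_point_of_face)
    then have "C \<subseteq> {x. G K x = G L x}"
      using C(1) gd[OF K(1)] gd[OF L(1)] by (auto simp: G_def)
    moreover have "convex {x. G K x = G L x}"
      by (rule convexI) (simp add: G[OF K(1)] G[OF L(1)])
    ultimately have "convex hull C \<subseteq> {x. G K x = G L x}"
      by (rule hull_minimal)
    then show ?thesis
      using C(2) K(2) L(2) by blast
  qed
  define f where "f x = G (SOME K. K \<in> T \<and> x \<in> K) x" for x
  have f: "f x = G K x" if "K \<in> T" "x \<in> K" for K x
  proof -
    have "(SOME K. K \<in> T \<and> x \<in> K) \<in> T \<and> x \<in> (SOME K. K \<in> T \<and> x \<in> K)"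
      by (rule someI[of "\<lambda>K. K \<in> T \<and> x \<in> K"]) (use that in blast)
    then show ?thesis
      unfolding f_def using agree that by blast
  qed
  have simplex: "closed K \<and> convex K" if "K \<in> T" for K
    using simplicial_complex_extreme_points[OF T that]
    by (metis aff_independent_finite compact_convex_hull compact_imp_closed convex_convex_hull finite_imp_compact)
  have "continuous_on K f" if K: "K \<in> T" for K
  proof -
    have "continuous_on K (G K)"
      unfolding G_def by (intro continuous_on_add continuous_on_const linear_continuous_on)
        (simp add: g[OF K] linear_linear)
    then show ?thesis
      using f[OF K] by (simp cong: continuous_on_cong)
  qed
  then have "continuous_on (\<Union>K\<in>T. K) f"
    using simplicial_complex_finite[OF T] simplex by (intro continuous_on_closed_Union) auto
  moreover have "f v = c v" if "{v} \<in> T" for v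
    using f[OF that] gd[OF that] by (simp add: G_def)
  moreover have "f (u *\<^sub>R x + v *\<^sub>R y) = u *\<^sub>R f x + v *\<^sub>R f y"
    if "K \<in> T" "x \<in> K" "y \<in> K" "u \<ge> 0" "v \<ge> 0" "u + v = 1" for K x y u v
  proof -
    have "u *\<^sub>R x + v *\<^sub>R y \<in> K"
      using that simplex[OF that(1)] by (auto intro: convexD)
    then show ?thesis
      using that by (simp add: f[OF that(1)] G)
  qed
  ultimately show ?thesis
    using that[of f] by simp
qed

text \<open>
  Sperner's lemma: without a rainbow triangle, sending the colours to the corners of a triangle
  around \<open>0\<close> gives a simplicial map to the punctured plane, but the loop \<open>pqrs\<close> winds around \<open>0\<close>.
\<close>

theorem sperner_quadrilateral:
  fixes col :: "'a::euclidean_space \<Rightarrow> nat"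
  assumes T: "simplicial_complex T" "simply_connected (\<Union>T)"
    and edges: "closed_segment p q \<in> T" "closed_segment q r \<in> T" "closed_segment r s \<in> T" "closed_segment s p \<in> T"
    and range: "range col \<subseteq> {0, 1, 2}"
    and col: "col p = 0" "col q = 1" "col r \<in> {1, 2}" "col s = 2"
  shows "\<exists>a b c. convex hull {a, b, c} \<in> T \<and> 2 simplex (convex hull {a, b, c}) \<and>
    col a = 0 \<and> col b = 1 \<and> col c = 2"
proof (rule ccontr)
  assume no: "\<not> ?thesis"
  note face = simplicial_complex_face[OF T(1)]
  \<comment> \<open>The corners go counterclockwise around 0, so that each side, traversed in the
    order of the colours, has positive winding.\<close>
  define corner :: "nat \<Rightarrow> complex" where
    "corner n = (if n = 0 then Complex (-1) (-1) else if n = 1 then Complex 1 (-1) else \<i>)" for n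
  obtain f where f: "continuous_on (\<Union>T) f" "\<And>v. {v} \<in> T \<Longrightarrow> f v = corner (col v)"
    and affine: "\<And>K x y u v. K \<in> T \<Longrightarrow> x \<in> K \<Longrightarrow> y \<in> K \<Longrightarrow> u \<ge> 0 \<Longrightarrow> v \<ge> 0 \<Longrightarrow> u + v = (1::real) \<Longrightarrow>
      f (u *\<^sub>R x + v *\<^sub>R y) = u *\<^sub>R f x + v *\<^sub>R f y"
    using simplicial_map_exists[OF T(1), of "\<lambda>v. corner (col v)"] by blast
  have nonzero: "f x \<noteq> 0" if x: "K \<in> T" "x \<in> K" for K x
  proof -
    obtain C where C: "\<not> affine_dependent C" "K = convex hull C"
      using simplicial_complex_simplex[OF T(1) x(1)] by blast
    have subface: "convex hull D \<in> T" if "D \<subseteq> C" for D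
      using face[OF x(1)] that C face_of_convex_hull_affine_independent by blast
    have fC: "f v = corner (col v)" if "v \<in> C" for v
      using subface[of "{v}"] that f(2) by simp
    \<comment> \<open>A simplex that misses the colour \<open>i\<close> is mapped into the side
      opposite the corner of \<open>i\<close>, and no side contains 0.\<close>
    have "\<exists>i\<in>{0, 1, 2}. \<forall>v\<in>C. col v \<noteq> i"
    proof (rule ccontr)
      assume "\<not> ?thesis"
      then have "\<exists>a\<in>C. col a = 0" "\<exists>b\<in>C. col b = 1" "\<exists>c\<in>C. col c = 2"
        by simp_all
      then obtain a b c where abc: "a \<in> C" "b \<in> C" "c \<in> C" "col a = 0" "col b = 1" "col c = 2"
        by blast
      then have "card {a, b, c} = 3"
        by (auto simp: card_insert_if)
      moreover have "\<not> affine_dependent {a, b, c}"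
        using affine_independent_subset[OF C(1)] abc by simp
      ultimately have "2 simplex (convex hull {a, b, c})"
        unfolding simplex_def by (intro exI[of _ "{a, b, c}"]) simp
      then show False
        using no subface[of "{a, b, c}"] abc by blast
    qed
    then obtain i where i: "i \<in> {0, 1, 2}" "\<And>v. v \<in> C \<Longrightarrow> col v \<noteq> i"
      by blast
    obtain S where S: "convex S" "0 \<notin> S" "\<And>v. v \<in> C \<Longrightarrow> f v \<in> S"
    proof
      let ?j = "if i = 0 then 1 else 0" and ?k = "if i = 2 then 1 else 2"
      show "convex (closed_segment (corner ?j) (corner ?k))"
        by simp
      show "0 \<notin> closed_segment (corner ?j) (corner ?k)"
        using i(1) by (auto simp: corner_def closed_segment_def complex_eq_iff algebra_simps)
      show "f v \<in> closed_segment (corner ?j) (corner ?k)" if "v \<in> C" for v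
      proof -
        have "col v = ?j \<or> col v = ?k"
          using i that range by (auto dest: subsetD[of _ _ "col v"])
        then show ?thesis
          using fC[OF that] by auto
      qed
    qed
    have "convex {x \<in> convex hull C. f x \<in> S}"
    proof (rule convexI)
      fix y z u v
      assume "y \<in> {x \<in> convex hull C. f x \<in> S}" "z \<in> {x \<in> convex hull C. f x \<in> S}"
        and uv: "0 \<le> u" "0 \<le> v" "u + v = (1::real)"
      then show "u *\<^sub>R y + v *\<^sub>R z \<in> {x \<in> convex hull C. f x \<in> S}"
        using affine[OF x(1), of y z u v] C(2) convexD[OF S(1)] convexD[OF convex_convex_hull] by auto
    qed
    moreover have "C \<subseteq> {x \<in> convex hull C. f x \<in> S}"
      using S(3) by (auto intro: hull_inc)
    ultimately have "convex hull C \<subseteq> {x \<in> convex hull C. f x \<in> S}"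
      by (rule hull_minimal[rotated])
    then show ?thesis
      using x(2) C(2) S(2) by auto
  qed
  have vertex: "{a} \<in> T" "{b} \<in> T" if "closed_segment a b \<in> T" for a b
    using face[OF that] by (auto simp: face_of_singleton extreme_point_of_segment)
  have winding: "winding_number (f \<circ> linepath a b) 0 = winding_number (linepath (corner (col a)) (corner (col b))) 0"
    if "closed_segment a b \<in> T" for a b
  proof (rule winding_number_cong)
    fix t :: real assume "0 \<le> t" "t \<le> 1"
    then show "(f \<circ> linepath a b) t = linepath (corner (col a)) (corner (col b)) t"
      using affine[OF that, of a b "1 - t" t] vertex[OF that, THEN f(2)]
      by (simp add: linepath_def)
  qed
  have path: "path (f \<circ> linepath a b)" "0 \<notin> path_image (f \<circ> linepath a b)" if "closed_segment a b \<in> T" for a b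
    using that nonzero[OF that]
    by (auto intro!: path_continuous_image continuous_on_subset[OF f(1)] simp: path_image_compose)
  define loop where "loop = linepath p q +++ linepath q r +++ linepath r s +++ linepath s p"
  have "path loop" "path_image loop \<subseteq> \<Union>T" "pathfinish loop = pathstart loop"
    using edges by (auto simp: loop_def path_image_join)
  moreover have p: "p \<in> \<Union>T"
    using vertex[OF edges(1)] by blast
  ultimately have "homotopic_loops (\<Union>T) loop (linepath p p)"
    using T(2) unfolding simply_connected_eq_contractible_loop_any by blast
  \<comment> \<open>The contraction of the boundary loop is carried by \<open>f\<close> into the
    punctured plane.\<close>
  then have "homotopic_loops (- {0}) (f \<circ> loop) (f \<circ> linepath p p)"
    using f(1) by (rule homotopic_loops_continuous_image) (use nonzero in auto)
  then have "winding_number (f \<circ> loop) 0 = winding_number (f \<circ> linepath p p) 0"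
    by (rule winding_number_homotopic_loops)
  also have "\<dots> = 0"
    using nonzero p by (intro winding_number_constI[of "f p"]) (auto simp: linepath_refl)
  finally have "winding_number (f \<circ> loop) 0 = 0" .
  moreover have "winding_number (f \<circ> loop) 0 =
      winding_number (linepath (corner (col p)) (corner (col q))) 0 +
      (winding_number (linepath (corner (col q)) (corner (col r))) 0 +
      (winding_number (linepath (corner (col r)) (corner (col s))) 0 +
       winding_number (linepath (corner (col s)) (corner (col p))) 0))"
    using path edges unfolding loop_def path_compose_join
    by (simp add: winding_number_join winding path_image_join pathfinish_compose pathstart_compose)
  \<comment> \<open>As \<open>r\<close> has the colour of \<open>q\<close> or of \<open>s\<close>,
    one of the four image segments is constant. The other three are the sides of the triangle and
    contribute positive real parts.\<close>
  moreover have pos: "Re (winding_number (linepath (corner 0) (corner 1)) 0) > 0"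
    "Re (winding_number (linepath (corner 1) (corner 2)) 0) > 0"
    "Re (winding_number (linepath (corner 2) (corner 0)) 0) > 0"
    by (rule winding_number_linepath_pos_lt; simp add: corner_def)+
  moreover have "winding_number (linepath (corner i) (corner i)) 0 = 0" for i
    by (rule winding_number_trivial) (simp add: corner_def complex_eq_iff)
  ultimately show False
    using col by (auto simp: complex_eq_iff)
qed

section \<open>Areas in integral domains\<close>

text \<open>The area is alternating. The sign is harmless because subrings are closed under
  negation.\<close>

lemma twice_area_permute:
  assumes "{a, b, c} = {a', b', c'}" "a \<noteq> b" "b \<noteq> c" "c \<noteq> a"
  shows "twice_area x y (a, b, c) \<in> {twice_area x y (a', b', c'), - twice_area x y (a', b', c')}"
proof -
  have "a \<in> {a', b', c'}" "b \<in> {a', b', c'}" "c \<in> {a', b', c'}"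
    using assms(1) by blast+
  then have "(a, b, c) \<in> {(a', b', c'), (b', c', a'), (c', a', b'), (a', c', b'), (c', b', a'), (b', a', c')}"
    using assms(2-4) by auto
  then show ?thesis
    by (auto simp: algebra_simps)
qed

text \<open>The three vertices of the simplex are the extreme points of the hull, so they occur in,
  and exhaust, any triple spanning it.\<close>

lemma triangle_vertices:
  fixes a b c a' b' c' :: "'a::euclidean_space"
  assumes "2 simplex (convex hull {a, b, c})" "convex hull {a, b, c} = convex hull {a', b', c'}"
  shows "{a, b, c} = {a', b', c'}"
proof -
  obtain C where C: "\<not> affine_dependent C" "card C = 3" "convex hull {a, b, c} = convex hull C"
    using assms(1) unfolding simplex_def by auto
  have "C = {u, v, w}" if "convex hull {u, v, w} = convex hull C" for u v w
  proof (rule card_subset_eq)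
    show "C \<subseteq> {u, v, w}"
      using C(1) that extreme_point_of_convex_hull
      by (metis extreme_point_of_convex_hull_affine_independent subsetI)
    then show "card C = card {u, v, w}"
      using C(2) card_mono[of "{u, v, w}" C] by (auto simp: card_insert_if split: if_splits)
  qed simp
  then show ?thesis
    using C(3) assms(2) by metis
qed

text \<open>The rainbow triangle from Sperner's lemma is some \<open>\<Delta> i\<close> up to the
  order of its vertices, so its area is a generator up to sign.\<close>

lemma area_integral_field:
  fixes x y :: "'a::euclidean_space \<Rightarrow> 'k::field"
  assumes T: "quad_triangulation T p q r s"
    and \<Delta>: "oriented_triangle_list T p q r s n \<Delta>"
    and r: "x r = x s + t * (x q - x p)" "y r = y s + t * (y q - y p)"
  shows "integral_over (subring_generated ((\<lambda>i. twice_area x y (\<Delta> i)) ` {1..n})) (twice_area x y (p, s, q))"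
proof (rule integral_if_rainbow_area[OF subring_generated_subring r])
  let ?A = "subring_generated ((\<lambda>i. twice_area x y (\<Delta> i)) ` {1..n})"
  fix col :: "'a \<Rightarrow> nat"
  assume col: "range col \<subseteq> {0, 1, 2}" "col p = 0" "col q = 1" "col r \<in> {1, 2}" "col s = 2"
  have complex: "simplicial_complex T" and edges: "closed_segment p q \<in> T" "closed_segment q r \<in> T"
    "closed_segment r s \<in> T" "closed_segment s p \<in> T" and "\<Union>T homeomorphic cball (0::complex) 1"
    using T by (auto simp: quad_triangulation_def homeomorphic_def)
  then have "simply_connected (\<Union>T)"
    using homeomorphic_simply_connected_eq convex_imp_simply_connected convex_cball by blast
  then obtain a b c where abc: "convex hull {a, b, c} \<in> T" "2 simplex (convex hull {a, b, c})"
    and abc_col: "col a = 0" "col b = 1" "col c = 2"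
    using sperner_quadrilateral[OF complex _ edges col] by blast
  then have "convex hull {a, b, c} \<in> (\<lambda>i. triangle_hull (\<Delta> i)) ` {1..n}"
    using \<Delta> by (simp add: oriented_triangle_list_def bij_betw_def triangles_def)
  then obtain i where i: "i \<in> {1..n}" "triangle_hull (\<Delta> i) = convex hull {a, b, c}"
    by auto
  obtain a' b' c' where \<Delta>i: "\<Delta> i = (a', b', c')"
    by (cases "\<Delta> i")
  have "{a, b, c} = {a', b', c'}"
    using triangle_vertices[OF abc(2)] i(2) \<Delta>i by simp
  then have "twice_area x y (a, b, c) \<in> {twice_area x y (\<Delta> i), - twice_area x y (\<Delta> i)}"
    unfolding \<Delta>i using abc_col by (intro twice_area_permute) auto
  moreover have "twice_area x y (\<Delta> i) \<in> ?A"
    using i(1) by (intro hull_inc) simp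
  ultimately have "twice_area x y (a, b, c) \<in> ?A"
    using subring_uminus[OF subring_generated_subring] by auto
  then show "\<exists>a b c. col a = 0 \<and> col b = 1 \<and> col c = 2 \<and> twice_area x y (a, b, c) \<in> ?A"
    using abc_col by blast
qed

section \<open>Transfer along ring homomorphisms\<close>

locale ring_homomorphism =
  fixes h :: "'b::comm_ring_1 \<Rightarrow> 'c::comm_ring_1"
  assumes hom_1: "h 1 = 1"
    and hom_diff: "h (a - b) = h a - h b"
    and hom_mult: "h (a * b) = h a * h b"
begin

lemma hom_0: "h 0 = 0"
  using hom_diff[of 0 0] by simp

lemma hom_add: "h (a + b) = h a + h b"
  using hom_diff[of a "0 - b"] hom_diff[of 0 b] by (simp add: hom_0)

lemma hom_poly: "h (poly f w) = poly (map_poly h f) (h w)"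
  by (induction f) (simp_all add: map_poly_pCons hom_0 hom_add hom_mult)

lemma hom_twice_area: "h (twice_area x y t) = twice_area (\<lambda>v. h (x v)) (\<lambda>v. h (y v)) t"
  by (cases t) (simp add: hom_diff hom_mult)

lemma image_subring_generated: "h ` subring_generated S = subring_generated (h ` S)"
proof
  have "is_subring (h -` subring_generated (h ` S))"
    using subring_generated_subring[of "h ` S"] by (auto simp: is_subring_def hom_1 hom_diff hom_mult)
  then have "subring_generated S \<subseteq> h -` subring_generated (h ` S)"
    by (intro hull_minimal) (auto intro: hull_inc)
  then show "h ` subring_generated S \<subseteq> subring_generated (h ` S)"
    by blast
  have "is_subring (h ` subring_generated S)"
    using subring_generated_subring[of S]
    by (auto simp: is_subring_def simp flip: hom_1 hom_diff hom_mult)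
  then show "subring_generated (h ` S) \<subseteq> h ` subring_generated S"
    by (intro hull_minimal) (auto intro: hull_inc)
qed

lemma integral_over_image:
  assumes "integral_over A w"
  shows "integral_over (h ` A) (h w)"
proof -
  obtain f where f: "lead_coeff f = 1" "\<And>i. coeff f i \<in> A" "poly f w = 0"
    using assms unfolding integral_over_def by blast
  have "degree (map_poly h f) = degree f"
    by (intro map_poly_degree_eq) (simp add: f(1) hom_1)
  then have "lead_coeff (map_poly h f) = 1"
    by (simp add: coeff_map_poly hom_0 hom_1 f(1))
  moreover have "poly (map_poly h f) (h w) = 0"
    using hom_poly[of f w] f(3) hom_0 by simp
  ultimately show ?thesis
    unfolding integral_over_def using f(2) by (intro exI[of _ "map_poly h f"]) (auto simp: coeff_map_poly hom_0)
qed

lemma integral_over_inj_image: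
  assumes "inj h" "integral_over (h ` A) (h w)"
  shows "integral_over A w"
proof -
  obtain f where f: "lead_coeff f = 1" "\<And>i. coeff f i \<in> h ` A" "poly f (h w) = 0"
    using assms unfolding integral_over_def by blast
  \<comment> \<open>All coefficients of \<open>f\<close> lie in the image of \<open>A\<close>, where
    \<open>inv h\<close> returns their unique preimages; thus \<open>g\<close> has coefficients in
    \<open>A\<close>.\<close>
  define g where "g = map_poly (inv h) f"
  have inv: "inv h 0 = 0" "inv h 1 = 1"
    using inv_f_f[OF assms(1)] hom_0 hom_1 by metis+
  have "degree g = degree f"
    unfolding g_def by (intro map_poly_degree_eq) (simp add: f(1) inv)
  then have "lead_coeff g = 1"
    by (simp add: g_def coeff_map_poly inv f(1))
  moreover have "coeff g i \<in> A" for i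
    using f(2)[of i] inv_f_f[OF assms(1)] by (auto simp: g_def coeff_map_poly inv)
  moreover have "map_poly h g = f"
  proof (rule poly_eqI)
    fix i
    show "coeff (map_poly h g) i = coeff f i"
      using f(2)[of i] inv_f_f[OF assms(1)] by (auto simp: g_def coeff_map_poly inv hom_0)
  qed
  then have "h (poly g w) = h 0"
    using hom_poly[of g w] f(3) hom_0 by simp
  then have "poly g w = 0"
    using assms(1) by (rule injD[rotated])
  ultimately show ?thesis
    unfolding integral_over_def by blast
qed

end

text \<open>The field case applies in the fraction field, and integrality descends along the
  embedding.\<close>

lemma area_integral_idom:
  fixes x y :: "'a::euclidean_space \<Rightarrow> 'k::idom"
  assumes T: "quad_triangulation T p q r s"
    and \<Delta>: "oriented_triangle_list T p q r s n \<Delta>"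
    and r: "x r = x s + t * (x q - x p)" "y r = y s + t * (y q - y p)"
  shows "integral_over (subring_generated ((\<lambda>i. twice_area x y (\<Delta> i)) ` {1..n})) (twice_area x y (p, s, q))"
proof -
  define h :: "'k \<Rightarrow> 'k fract" where "h a = Fract a 1" for a
  interpret ring_homomorphism h
    by unfold_locales (simp_all add: h_def One_fract_def)
  have "inj h"
    by (rule injI) (simp add: h_def eq_fract)
  have "integral_over (subring_generated ((\<lambda>i. twice_area (\<lambda>v. h (x v)) (\<lambda>v. h (y v)) (\<Delta> i)) ` {1..n}))
    (twice_area (\<lambda>v. h (x v)) (\<lambda>v. h (y v)) (p, s, q))"
    using T \<Delta> by (rule area_integral_field[where t = "h t"]) (simp_all add: r hom_add hom_mult hom_diff)
  then have "integral_over (h ` subring_generated ((\<lambda>i. twice_area x y (\<Delta> i)) ` {1..n})) (h (twice_area x y (p, s, q)))"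
    unfolding image_subring_generated image_image hom_twice_area .
  then show ?thesis
    by (rule integral_over_inj_image[OF \<open>inj h\<close>])
qed

section \<open>Polynomial rings\<close>

text \<open>
  The library proves \<open>idom\<close> for polynomials only over linearly ordered indeterminates, so the
  theorem is proved for indeterminates carrying a well-ordering and then mapped to the
  polynomial ring of the theorem by renaming them.
\<close>

datatype 'i well_ordered = Well_ordered (unordered: 'i)

instantiation well_ordered :: (type) linorder
begin

definition less_eq_well_ordered_def:
  "x \<le> (y :: 'a well_ordered) \<longleftrightarrow> (unordered x, unordered y) \<in> (SOME r. well_order_on UNIV r)"

definition less_well_ordered_def:
  "x < (y :: 'a well_ordered) \<longleftrightarrow> x \<le> y \<and> \<not> y \<le> x"

instance
proof
  let ?r = "SOME r. well_order_on (UNIV :: 'a set) r"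
  have "well_order_on UNIV ?r"
    using well_order_on by (rule someI_ex)
  then have r: "refl ?r" "trans ?r" "antisym ?r" "total ?r"
    by (auto simp: well_order_on_def linear_order_on_def partial_order_on_def preorder_on_def)
  fix x y z :: "'a well_ordered"
  show "x \<le> x"
    using r(1) by (simp add: less_eq_well_ordered_def refl_on_def)
  show "x \<le> y \<Longrightarrow> y \<le> z \<Longrightarrow> x \<le> z"
    using r(2) by (auto simp: less_eq_well_ordered_def dest: transD)
  show "x \<le> y \<Longrightarrow> y \<le> x \<Longrightarrow> x = y"
    using r(3) by (auto simp: less_eq_well_ordered_def intro: well_ordered.expand dest: antisymD)
  show "x \<le> y \<or> y \<le> x"
    using r(1,4) unfolding less_eq_well_ordered_def refl_on_def total_on_def by (metis UNIV_I)
  show "x < y \<longleftrightarrow> x \<le> y \<and> \<not> y \<le> x"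
    by (rule less_well_ordered_def)
qed

end

lemma lookup_map_key:
  "inj g \<Longrightarrow> Poly_Mapping.lookup (Poly_Mapping.map_key g f) k = Poly_Mapping.lookup f (g k)"
  by (simp add: map_key.rep_eq)

lemma map_key_diff:
  fixes f g :: "'a \<Rightarrow>\<^sub>0 'b::ab_group_add"
  assumes "inj \<mu>"
  shows "Poly_Mapping.map_key \<mu> (f - g) = Poly_Mapping.map_key \<mu> f - Poly_Mapping.map_key \<mu> g"
  by (rule poly_mapping_eqI) (simp add: lookup_map_key[OF assms] lookup_minus)

text \<open>A coefficient of a product is a sum over pairs of monomials with a given sum; a
  bijective additive \<open>\<mu>\<close> merely reindexes these pairs.\<close>

lemma map_key_mult:
  fixes f g :: "'a::monoid_add \<Rightarrow>\<^sub>0 'b::semiring_0" and \<mu> :: "'c::monoid_add \<Rightarrow> 'a"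
  assumes \<mu>: "bij \<mu>" "\<And>k l. \<mu> (k + l) = \<mu> k + \<mu> l"
  shows "Poly_Mapping.map_key \<mu> (f * g) = Poly_Mapping.map_key \<mu> f * Poly_Mapping.map_key \<mu> g"
proof (rule poly_mapping_eqI)
  fix k
  have reindex: "Sum_any (\<lambda>l. F (\<mu> l)) = Sum_any F" for F :: "'a \<Rightarrow> 'b"
    by (rule Sum_any.reindex_cong[OF \<mu>(1), symmetric]) (simp add: comp_def)
  have inj: "inj \<mu>"
    using \<mu>(1) by (rule bij_is_inj)
  have "\<mu> k = \<mu> l + \<mu> q \<longleftrightarrow> k = l + q" for l q
    unfolding \<mu>(2)[symmetric] using inj by (rule inj_eq)
  then show "Poly_Mapping.lookup (Poly_Mapping.map_key \<mu> (f * g)) k =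
      Poly_Mapping.lookup (Poly_Mapping.map_key \<mu> f * Poly_Mapping.map_key \<mu> g) k"
    unfolding lookup_map_key[OF inj] times_poly_mapping.rep_eq prod_fun_def
    by (simp add: lookup_map_key[OF inj] flip: reindex)
qed

text \<open>\<open>map_key\<close> precomposes and so reverses direction. Applied twice, as in
  \<open>rename\<close>, it leads from polynomials in well-ordered indeterminates to those in the
  original ones.\<close>

definition rename_monomial :: "('i \<Rightarrow>\<^sub>0 nat) \<Rightarrow> ('i well_ordered \<Rightarrow>\<^sub>0 nat)" where
  "rename_monomial = Poly_Mapping.map_key unordered"

definition rename :: "(('i well_ordered \<Rightarrow>\<^sub>0 nat) \<Rightarrow>\<^sub>0 complex) \<Rightarrow> (('i \<Rightarrow>\<^sub>0 nat) \<Rightarrow>\<^sub>0 complex)" where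
  "rename = Poly_Mapping.map_key rename_monomial"

lemma inj_unordered: "inj unordered" and inj_Well_ordered: "inj Well_ordered"
  by (auto intro!: injI well_ordered.expand)

lemma rename_monomial_0: "rename_monomial 0 = 0"
  unfolding rename_monomial_def by (rule map_key_zero[OF inj_unordered])

lemma rename_monomial_add: "rename_monomial (k + l) = rename_monomial k + rename_monomial l"
  unfolding rename_monomial_def by (rule map_key_plus[OF inj_unordered])

lemma bij_rename_monomial: "bij rename_monomial"
proof (rule bij_betw_byWitness)
  show "\<forall>m\<in>UNIV. Poly_Mapping.map_key Well_ordered (rename_monomial m) = m"
    "\<forall>m\<in>UNIV. rename_monomial (Poly_Mapping.map_key Well_ordered m) = m"
    by (auto simp: rename_monomial_def lookup_map_key inj_unordered inj_Well_ordered
        intro!: poly_mapping_eqI)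
qed auto

lemma rename_single:
  "rename (Poly_Mapping.single (Poly_Mapping.single (Well_ordered i) k) c) =
    Poly_Mapping.single (Poly_Mapping.single i k) c"
proof -
  have "Poly_Mapping.single (Well_ordered i) k = rename_monomial (Poly_Mapping.single i k)"
    unfolding rename_monomial_def
    using map_key_single[OF inj_unordered, of "Well_ordered i" k] by simp
  then show ?thesis
    unfolding rename_def using map_key_single[OF bij_is_inj[OF bij_rename_monomial]] by simp
qed

interpretation rename: ring_homomorphism rename
proof
  have inj: "inj rename_monomial"
    using bij_rename_monomial by (rule bij_is_inj)
  show "rename 1 = 1"
    using map_key_single[OF inj, of 0 "1 :: complex"]
    by (simp add: rename_def rename_monomial_0)
  show "rename (a - b) = rename a - rename b" for a b
    unfolding rename_def by (rule map_key_diff[OF inj])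
  show "rename (a * b) = rename a * rename b" for a b
    unfolding rename_def by (rule map_key_mult[OF bij_rename_monomial rename_monomial_add])
qed

theorem theorem4:
  fixes T :: "'a::euclidean_space set set"
    and p q r s :: 'a
    and n :: nat
    and \<Delta> :: "nat \<Rightarrow> 'a \<times> 'a \<times> 'a"
  assumes "quad_triangulation T p q r s"
    and "oriented_triangle_list T p q r s n \<Delta>"
  shows "integral_over
           (subring_generated ((\<lambda>i. area_poly p q r s (\<Delta> i)) ` {1..n}))
           (area_poly p q r s (p, s, q))"
proof -
  \<comment> \<open>Lifts of the indeterminates to the ring that is known to be a domain;
    \<open>x\<close> and \<open>y\<close> are the corresponding lifts of the coordinates, with the
    same relation at \<open>r\<close>.\<close>
  define X :: "'a indet \<Rightarrow> ('a indet well_ordered \<Rightarrow>\<^sub>0 nat) \<Rightarrow>\<^sub>0 complex" where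
    "X i = Poly_Mapping.single (Poly_Mapping.single (Well_ordered i) 1) 1" for i
  have X: "rename (X i) = indet i" for i
    by (simp add: X_def indet_def rename_single)
  define x y where "x v = (if v = r then X (IX s) + X IT * (X (IX q) - X (IX p)) else X (IX v))"
    and "y v = (if v = r then X (IY s) + X IT * (X (IY q) - X (IY p)) else X (IY v))" for v
  have xy: "rename (x v) = xcoord p q r s v" "rename (y v) = ycoord p q r s v" for v
    by (simp_all add: x_def y_def xcoord_def ycoord_def X rename.hom_add rename.hom_diff rename.hom_mult)
  have "p \<noteq> r" "q \<noteq> r" "s \<noteq> r"
    using assms(1) by (auto simp: quad_triangulation_def)
  then have "x r = x s + X IT * (x q - x p)" "y r = y s + X IT * (y q - y p)"
    unfolding x_def y_def by (simp_all only: if_False refl if_True)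
  then have "integral_over (subring_generated ((\<lambda>i. twice_area x y (\<Delta> i)) ` {1..n})) (twice_area x y (p, s, q))"
    by (rule area_integral_idom[OF assms])
  from rename.integral_over_image[OF this] show ?thesis
    unfolding rename.image_subring_generated image_image rename.hom_twice_area xy .
qed

end
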